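(* Let $p$ be a prime number, let $q=p^2$, let $N\geq 1$ be a divisor of $q-1$, let $n:\mathbb{F}_q\to\{0,1,2,\ldots\}$ be a function, and suppose that $$A=\prod_{\gamma\in\mathbb{F}_q}(x-\gamma)^{Np^{n(\gamma)}-1}\in\mathbb{F}_q[x]$$ is a perfect polynomial over $\mathbb{F}_q$. Then: (i) If $N$ divides $p-1$, then $A$ is trivially perfect. (ii) If $N$ does not divide $p-1$, then $n(\gamma)=n(\delta)$ for all $\gamma,\delta\in\mathbb{F}_q$; denoting this common value by $n$, one has $A=(x^q-x)^{Np^n-1}$.
   Context: For a monic polynomial $A\in\mathbb{F}_q[x]$, $\sigma(A)$ denotes the sum of all monic divisors of $A$ in $\mathbb{F}_q[x]$ (including $1$ and $A$). A monic polynomial $A$ is perfect over $\mathbb{F}_q$ if $A$ divides $\sigma(A)$ (equivalently $\sigma(A)=A$). Trivially perfect: group the linear factors of $A=\prod_{\gamma\in\mathbb{F}_q}(x-\gamma)^{Np^{n(\gamma)}-1}$ according to the additive cosets $a+\mathbb{F}_p$ of $\mathbb{F}_p$ in $\mathbb{F}_q$, that is, write $A$ as the product over these cosets of the polynomials $A_{a}=\prod_{j\in\mathbb{F}_p}(x-a-j)^{Np^{n(a+j)}-1}$ ($a$ running through a set of coset representatives). Then $A$ is called trivially perfect if every factor $A_{a}$ is a perfect polynomial over $\mathbb{F}_q$. *)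

theory Defs
  imports "HOL-Computational_Algebra.Computational_Algebra"
begin

definition monic_divisors :: "'a :: field poly \<Rightarrow> 'a poly set" where
  "monic_divisors A = {D. lead_coeff D = 1 \<and> D dvd A}"

definition sigma_poly :: "'a :: field poly \<Rightarrow> 'a poly" where
  "sigma_poly A = (\<Sum>D\<in>monic_divisors A. D)"

definition perfect_poly :: "'a :: field poly \<Rightarrow> bool" where
  "perfect_poly A \<longleftrightarrow> lead_coeff A = 1 \<and> A dvd sigma_poly A"

text \<open>
  The sum defining \<^const>\<open>sigma_poly\<close> is a genuine finite sum for nonzero polynomials
  over a finite field.
\<close>
lemma finite_monic_divisors:
  fixes A :: "'a :: finite_field poly"
  assumes "A \<noteq> 0"
  shows "finite (monic_divisors A)"
proof (rule finite_subset)
  show "monic_divisors A \<subseteq> Poly ` {xs. set xs \<subseteq> UNIV \<and> length xs \<le> Suc (degree A)}"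
  proof
    fix D assume "D \<in> monic_divisors A"
    then have "degree D \<le> degree A"
      using assms by (auto simp: monic_divisors_def intro: dvd_imp_degree_le)
    then have "length (coeffs D) \<le> Suc (degree A)"
      by (cases "D = 0") (auto simp: length_coeffs_degree)
    then show "D \<in> Poly ` {xs. set xs \<subseteq> UNIV \<and> length xs \<le> Suc (degree A)}"
      by (intro image_eqI[of _ _ "coeffs D"]) auto
  qed
  show "finite (Poly ` {xs :: 'a list. set xs \<subseteq> UNIV \<and> length xs \<le> Suc (degree A)})"
    by (intro finite_imageI finite_lists_length_le) auto
qed

text \<open>The copy of \<open>\<int>/p\<close> inside a field of characteristic \<open>p\<close>.\<close>
definition prime_subfield :: "'a :: field set" where
  "prime_subfield = range of_nat"

definition coset_factor :: "nat \<Rightarrow> nat \<Rightarrow> ('a :: field \<Rightarrow> nat) \<Rightarrow> 'a \<Rightarrow> 'a poly" where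
  "coset_factor p N n a = (\<Prod>j\<in>prime_subfield. [:- (a + j), 1:] ^ (N * p ^ n (a + j) - 1))"

text \<open>
  This is a property of
  \<open>A = (\<Prod>\<gamma>\<in>UNIV. [:-\<gamma>, 1:] ^ (N * p ^ n \<gamma> - 1))\<close>, given through the data \<open>p\<close>, \<open>N\<close>, \<open>n\<close>
  that determine its exponents. Since \<^term>\<open>coset_factor p N n a\<close> depends only on the coset of
  \<open>a\<close> (see below), letting \<open>a\<close> range over the whole field amounts to letting it range over
  a set of coset representatives.
\<close>
definition trivially_perfect :: "nat \<Rightarrow> nat \<Rightarrow> ('a :: field \<Rightarrow> nat) \<Rightarrow> bool" where
  "trivially_perfect p N n \<longleftrightarrow> (\<forall>a. perfect_poly (coset_factor p N n a))"

lemma coset_factor_coset: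
  "coset_factor p N n a =
     (\<Prod>\<gamma>\<in>(\<lambda>j. a + j) ` prime_subfield. [:- \<gamma>, 1:] ^ (N * p ^ n \<gamma> - 1))"
  by (simp add: coset_factor_def prod.reindex)

end

theory Submission
  imports Defs
begin

text \<open>
  Write \<open>f \<delta> = p ^ n \<delta>\<close> and let \<open>U\<close> be the set of \<open>N\<close>-th roots of unity; since \<open>N\<close> divides
  \<open>q - 1\<close>, it has exactly \<open>N\<close> elements. The sum of divisors is multiplicative on products of
  powers of distinct linear factors. For one factor, a geometric sum and the Frobenius
  endomorphism give
  \<open>\<sigma>((x - \<gamma>) ^ (N f(\<gamma>) - 1)) = ((x - \<gamma>) ^ N - 1) ^ f(\<gamma>) / (x - \<gamma> - 1)\<close>,
  and the numerator is the product of \<open>(x - \<gamma> - \<zeta>) ^ f(\<gamma>)\<close> over \<open>\<zeta> \<in> U\<close>. So \<open>\<sigma>(A)\<close> again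
  splits into linear factors, and comparing the multiplicities of every root \<open>\<delta>\<close> turns
  perfectness into a linear condition on \<open>f\<close>:
  \<open>N f(\<delta>) \<le> (\<Sum>\<zeta>\<in>U. f(\<delta> - \<zeta>))\<close> for all \<open>\<delta>\<close>
  (\<open>perfect_poly_iff_subharmonic\<close>). The same equivalence holds for the part of the product that
  runs over any set \<open>S\<close> closed under translation by \<open>U\<close>.

  If \<open>N\<close> divides \<open>p - 1\<close>, then \<open>U\<close> lies in the prime field, so every coset of the prime field
  is such a set \<open>S\<close>. The condition is local in \<open>\<delta>\<close>, hence it passes from the whole field to
  each coset, and every factor of \<open>A\<close> that belongs to a coset is perfect.

  If \<open>N\<close> does not divide \<open>p - 1\<close>, then some \<open>\<zeta> \<in> U\<close> lies outside the prime field. The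
  condition says that \<open>f\<close> is nowhere larger than its average over the translates by \<open>U\<close>. On a
  finite group this forces \<open>f\<close> to be invariant under these translations
  (\<open>subharmonic_imp_invariant\<close>). Thus \<open>1\<close> and \<open>\<zeta>\<close> are periods of \<open>n\<close>; because \<open>q = p\<^sup>2\<close>, they
  form a basis of the field over its prime field, and \<open>n\<close> is constant.
\<close>

section \<open>The sum of divisors of a product of linear factors\<close>

text \<open>
  Since \<open>c\<close> is not a root of \<open>Q\<close>, it is a root of the cofactor, so the linear factors can be
  cancelled one at a time.
\<close>
lemma dvd_linear_power_mult_cancel:
  fixes Q :: "'a :: field poly"
  assumes "Q dvd [:-c, 1:] ^ k * X" and "poly Q c \<noteq> 0"
  shows "Q dvd X"
  using assms(1)
proof (induction k)
  case (Suc k)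
  from Suc.prems obtain C where C: "[:-c, 1:] * ([:-c, 1:] ^ k * X) = Q * C"
    by (metis dvdE mult.assoc power_Suc)
  then have "poly Q c * poly C c = 0"
    by (metis poly_mult mult_zero_left poly_eq_0_iff_dvd dvd_refl)
  with assms(2) obtain C' where "C = [:-c, 1:] * C'"
    by (auto simp: poly_eq_0_iff_dvd dvd_def)
  with C have "[:-c, 1:] * ([:-c, 1:] ^ k * X) = [:-c, 1:] * (Q * C')"
    by (simp only: mult.left_commute)
  then have "[:-c, 1:] ^ k * X = Q * C'"
    by (subst (asm) mult_cancel_left) simp
  then show ?case
    by (intro Suc.IH) simp
qed simp

text \<open>
  Unique factorization at the root \<open>c\<close>: the monic divisors of the product are the
  \<open>(x - c) ^ i * D\<close> with \<open>i \<le> k\<close> and \<open>D\<close> a monic divisor of \<open>B\<close>, and \<open>i\<close> is recovered as the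
  order of the divisor at \<open>c\<close>.
\<close>
lemma sigma_poly_linear_power_mult:
  fixes B :: "'a :: field poly"
  assumes B: "poly B c \<noteq> 0"
  shows "sigma_poly ([:-c, 1:] ^ k * B) = (\<Sum>i\<le>k. [:-c, 1:] ^ i) * sigma_poly B"
proof -
  let ?L = "[:-c, 1:]" and ?M = "{..k} \<times> monic_divisors B"
  have B0: "B \<noteq> 0"
    using B by auto
  have nz: "D \<noteq> 0" "poly D c \<noteq> 0" if "D \<in> monic_divisors B" for D
    using that B by (auto simp: monic_divisors_def dvd_def)
  have ord: "order c (?L ^ i * D) = i" if "D \<noteq> 0" "poly D c \<noteq> 0" for i D
    using that by (subst order_mult) (auto simp: order_power_n_n order_0I)
  have "bij_betw (\<lambda>(i, D). ?L ^ i * D) ?M (monic_divisors (?L ^ k * B))"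
  proof (intro bij_betw_imageI subset_antisym subsetI)
    show "inj_on (\<lambda>(i, D). ?L ^ i * D) ?M"
    proof (rule inj_onI, clarify)
      fix i D j E
      assume *: "D \<in> monic_divisors B" "E \<in> monic_divisors B" "?L ^ i * D = ?L ^ j * E"
      then have "i = j"
        using ord nz by metis
      with * show "i = j \<and> D = E"
        by simp
    qed
  next
    fix D assume "D \<in> (\<lambda>(i, D). ?L ^ i * D) ` ?M"
    then show "D \<in> monic_divisors (?L ^ k * B)"
      by (auto simp: monic_divisors_def lead_coeff_mult lead_coeff_power
               intro!: mult_dvd_mono le_imp_power_dvd)
  next
    fix D assume "D \<in> monic_divisors (?L ^ k * B)"
    then have D: "lead_coeff D = 1" "D dvd ?L ^ k * B"
      by (auto simp: monic_divisors_def)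
    then have D0: "D \<noteq> 0"
      by auto
    then obtain Q where Q: "D = ?L ^ order c D * Q" "poly Q c \<noteq> 0"
      using order_decomp poly_eq_0_iff_dvd by metis
    have "order c D \<le> order c (?L ^ k * B)"
      using D B0 by (intro dvd_imp_order_le) auto
    then have "order c D \<le> k"
      using ord B B0 by metis
    moreover have "Q dvd B"
    proof (rule dvd_linear_power_mult_cancel)
      show "Q dvd ?L ^ k * B"
        using D(2) Q(1) by (metis dvd_mult_right)
    qed (rule Q(2))
    moreover have "lead_coeff Q = 1"
      using D(1) by (subst (asm) (1 2) Q(1)) (simp add: lead_coeff_mult lead_coeff_power)
    ultimately show "D \<in> (\<lambda>(i, D). ?L ^ i * D) ` ?M"
      by (intro image_eqI[of _ _ "(order c D, Q)"]) (auto simp: monic_divisors_def Q(1)[symmetric])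
  qed
  then have "sigma_poly (?L ^ k * B) = (\<Sum>(i, D)\<in>?M. ?L ^ i * D)"
    unfolding sigma_poly_def
    by (rule sum.reindex_bij_betw[where g = "\<lambda>D. D", symmetric])
  then show ?thesis
    by (simp add: sigma_poly_def sum_product sum.cartesian_product)
qed

lemma sigma_poly_prod_linear_powers:
  fixes e :: "'a :: field \<Rightarrow> nat"
  assumes "finite S"
  shows "sigma_poly (\<Prod>\<gamma>\<in>S. [:-\<gamma>, 1:] ^ e \<gamma>) = (\<Prod>\<gamma>\<in>S. \<Sum>i\<le>e \<gamma>. [:-\<gamma>, 1:] ^ i)"
  using assms
proof (induction S rule: finite_induct)
  case empty
  have "monic_divisors (1 :: 'a poly) = {1}"
    by (auto simp: monic_divisors_def is_unit_poly_iff pCons_one intro: exI[of _ 1])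
  then show ?case
    by (simp add: sigma_poly_def)
next
  case (insert c S)
  then have "poly (\<Prod>\<gamma>\<in>S. [:-\<gamma>, 1:] ^ e \<gamma>) c \<noteq> 0"
    by (auto simp: poly_prod)
  with insert show ?case
    by (simp add: sigma_poly_linear_power_mult)
qed

lemma order_prod_linear_powers:
  fixes e :: "'a :: field \<Rightarrow> nat"
  assumes "finite S" and "\<delta> \<in> S"
  shows "order \<delta> (\<Prod>\<gamma>\<in>S. [:-\<gamma>, 1:] ^ e \<gamma>) = e \<delta>"
proof -
  let ?R = "\<Prod>\<gamma>\<in>S - {\<delta>}. [:-\<gamma>, 1:] ^ e \<gamma>"
  have "poly ?R \<delta> \<noteq> 0"
    using assms by (auto simp: poly_prod)
  then have "order \<delta> ([:-\<delta>, 1:] ^ e \<delta> * ?R) = e \<delta>"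
    by (subst order_mult) (auto simp: order_power_n_n order_0I)
  then show ?thesis
    by (simp only: prod.remove[OF assms])
qed

lemma prod_linear_powers_dvd_iff:
  fixes e f :: "'a :: field \<Rightarrow> nat"
  assumes "finite S"
  shows "(\<Prod>\<gamma>\<in>S. [:-\<gamma>, 1:] ^ e \<gamma>) dvd (\<Prod>\<gamma>\<in>S. [:-\<gamma>, 1:] ^ f \<gamma>) \<longleftrightarrow> (\<forall>\<delta>\<in>S. e \<delta> \<le> f \<delta>)"
proof
  assume "(\<Prod>\<gamma>\<in>S. [:-\<gamma>, 1:] ^ e \<gamma>) dvd (\<Prod>\<gamma>\<in>S. [:-\<gamma>, 1:] ^ f \<gamma>)"
  then have le: "order \<delta> (\<Prod>\<gamma>\<in>S. [:-\<gamma>, 1:] ^ e \<gamma>) \<le> order \<delta> (\<Prod>\<gamma>\<in>S. [:-\<gamma>, 1:] ^ f \<gamma>)" for \<delta>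
    using assms by (intro dvd_imp_order_le) auto
  show "\<forall>\<delta>\<in>S. e \<delta> \<le> f \<delta>"
  proof
    fix \<delta> assume \<delta>: "\<delta> \<in> S"
    show "e \<delta> \<le> f \<delta>"
      using le[of \<delta>] by (simp only: order_prod_linear_powers[OF assms \<delta>])
  qed
qed (intro prod_dvd_prod le_imp_power_dvd, auto)

section \<open>Polynomials with all their roots in the field\<close>

lemma monic_eq_prod_roots:
  fixes P :: "'a :: field poly"
  assumes "lead_coeff P = 1" and "degree P \<le> card {x. poly P x = 0}"
  shows "P = (\<Prod>x | poly P x = 0. [:-x, 1:])"
proof -
  have P0: "P \<noteq> 0"
    using assms by auto
  then have fin: "finite {x. poly P x = 0}"
    by (rule poly_roots_finite)
  have card: "card {x. poly P x = 0} = degree P"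
    using card_poly_roots_bound[OF P0] assms by linarith
  have deg: "degree (\<Prod>x | poly P x = 0. [:-x, 1:]) = degree P"
    by (subst degree_prod_sum_eq) (auto simp: card)
  have lc: "lead_coeff (\<Prod>x | poly P x = 0. [:-x, 1:]) = 1"
    by (simp add: lead_coeff_prod)
  show ?thesis
    by (rule poly_eqI_degree_lead_coeff[where n = "degree P" and A = "{x. poly P x = 0}"])
       (use assms lc deg card fin in \<open>auto simp: poly_prod\<close>)
qed

lemma degree_lead_coeff_monom_minus_monom:
  assumes "k < m"
  shows "degree (monom 1 m - monom 1 k :: 'a :: field poly) = m"
    and "lead_coeff (monom 1 m - monom 1 k :: 'a :: field poly) = 1"
proof -
  show deg: "degree (monom 1 m - monom 1 k :: 'a poly) = m"
    using assms by (intro antisym degree_le le_degree) auto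
  show "lead_coeff (monom 1 m - monom 1 k :: 'a poly) = 1"
    using assms by (simp add: deg)
qed

lemma card_equal_powers_le:
  assumes "k < m"
  shows "card {x :: 'a :: field. x ^ m = x ^ k} \<le> m"
proof -
  let ?P = "monom 1 m - monom 1 k :: 'a poly"
  have "?P \<noteq> 0"
    using assms by (auto simp: monom_eq_iff')
  then show ?thesis
    using card_poly_roots_bound[of ?P] degree_lead_coeff_monom_minus_monom(1)[OF assms, where ?'a = 'a]
    by (simp add: poly_monom)
qed

lemma monom_card_minus_X:
  "monom 1 (card (UNIV :: 'a :: finite_field set)) - monom 1 1 = (\<Prod>\<gamma>\<in>(UNIV :: 'a set). [:-\<gamma>, 1:])"
proof -
  let ?q = "card (UNIV :: 'a set)"
  let ?P = "monom 1 ?q - monom 1 1 :: 'a poly"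
  have "card {0, 1 :: 'a} \<le> ?q"
    by (intro card_mono) auto
  then have q: "1 < ?q"
    by simp
  have roots: "{x. poly ?P x = 0} = UNIV"
    by (auto simp: poly_monom finite_field_power_card_eq_same)
  show ?thesis
    using monic_eq_prod_roots[of ?P] degree_lead_coeff_monom_minus_monom[OF q, where ?'a = 'a] roots by simp
qed

text \<open>
  With \<open>q - 1 = N k\<close>, factor \<open>x ^ (q - 1) - 1 = (x ^ N - 1) G\<close> with \<open>G\<close> of degree \<open>N (k - 1)\<close>.
  The left-hand side has \<open>N k\<close> roots and \<open>G\<close> takes at most \<open>N (k - 1)\<close> of them, which leaves at
  least \<open>N\<close> for \<open>x ^ N - 1\<close>.
\<close>
lemma card_roots_of_unity_finite_field:
  assumes N: "N dvd card (UNIV :: 'a :: finite_field set) - 1" "N \<ge> 1"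
  shows "card {\<zeta> :: 'a. \<zeta> ^ N = 1} = N"
proof -
  let ?q = "card (UNIV :: 'a set)"
  have "card {0, 1 :: 'a} \<le> ?q"
    by (intro card_mono) auto
  then have q: "1 < ?q"
    by simp
  obtain k where k: "?q - 1 = N * k"
    using N by auto
  with q have k0: "k > 0"
    by (intro Nat.gr0I) auto
  define G :: "'a poly" where "G = (\<Sum>i<k. monom 1 (N * i))"
  have degG: "degree G \<le> N * (k - 1)"
    unfolding G_def by (intro degree_sum_le) (auto simp: degree_monom_eq)
  \<comment> \<open>The exponents \<open>N i\<close> are distinct, so one coefficient equal to \<open>1\<close> shows \<open>G \<noteq> 0\<close>.\<close>
  have "coeff G (N * (k - 1)) = (\<Sum>i<k. if i = k - 1 then 1 else 0)"
    unfolding G_def coeff_sum using N by (intro sum.cong) auto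
  then have "G \<noteq> 0"
    using k0 by auto
  have upper: "card {\<zeta> :: 'a. \<zeta> ^ N = 1} \<le> N"
    using card_equal_powers_le[of 0 N, where ?'a = 'a] N by simp
  have "UNIV - {0} \<subseteq> {\<zeta> :: 'a. \<zeta> ^ N = 1} \<union> {x. poly G x = 0}"
  proof
    fix x :: 'a assume "x \<in> UNIV - {0}"
    then have "x ^ (?q - 1) = 1"
      using finite_field_power_card_eq_same[of x] q by (cases "?q") auto
    then have "(x ^ N) ^ k - 1 = 0"
      by (simp flip: power_mult k)
    moreover have "poly G x = (\<Sum>i<k. (x ^ N) ^ i)"
      by (simp add: G_def poly_sum poly_monom power_mult)
    ultimately have "(x ^ N - 1) * poly G x = 0"
      by (simp add: power_diff_1_eq)
    then show "x \<in> {\<zeta> :: 'a. \<zeta> ^ N = 1} \<union> {x. poly G x = 0}"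
      by auto
  qed
  then have "card (UNIV - {0 :: 'a}) \<le> card ({\<zeta> :: 'a. \<zeta> ^ N = 1} \<union> {x. poly G x = 0})"
    by (intro card_mono) auto
  also have "\<dots> \<le> card {\<zeta> :: 'a. \<zeta> ^ N = 1} + card {x. poly G x = 0}"
    by (rule card_Un_le)
  also have "card {x. poly G x = 0} \<le> N * (k - 1)"
    using card_poly_roots_bound[OF \<open>G \<noteq> 0\<close>] degG by linarith
  finally have "N * k \<le> card {\<zeta> :: 'a. \<zeta> ^ N = 1} + N * (k - 1)"
    using k by (simp add: card_Diff_singleton)
  with k0 have "N \<le> card {\<zeta> :: 'a. \<zeta> ^ N = 1}"
    by (cases k) auto
  with upper show ?thesis
    by simp
qed

text \<open>The splitting of \<open>x ^ N - 1\<close>, with \<open>x - \<gamma>\<close> substituted for \<open>x\<close>.\<close>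
lemma linear_power_minus_1_eq_prod:
  fixes \<gamma> :: "'a :: field"
  assumes "card {\<zeta> :: 'a. \<zeta> ^ N = 1} = N" and "N \<ge> 1"
  shows "[:-\<gamma>, 1:] ^ N - 1 = (\<Prod>\<zeta> | \<zeta> ^ N = 1. [:-(\<gamma> + \<zeta>), 1:])"
proof -
  have "monom 1 N - monom 1 0 = (\<Prod>\<zeta> | \<zeta> ^ N = 1. [:-\<zeta>, 1 :: 'a:])"
    using monic_eq_prod_roots[of "monom 1 N - monom 1 0 :: 'a poly"]
      degree_lead_coeff_monom_minus_monom[of 0 N, where ?'a = 'a] assms
    by (simp add: poly_monom)
  then have "pcompose (monom 1 N - monom 1 0) [:-\<gamma>, 1:] =
      pcompose (\<Prod>\<zeta> | \<zeta> ^ N = 1. [:-\<zeta>, 1 :: 'a:]) [:-\<gamma>, 1:]"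
    by simp
  moreover have "pcompose (P ^ k) Q = pcompose P Q ^ k" for P Q :: "'a poly" and k
    by (induction k) (simp_all add: pcompose_mult pcompose_1)
  ultimately show ?thesis
    by (simp add: pcompose_diff pcompose_prod pcompose_pCons monom_altdef one_pCons
        minus_add_distrib algebra_simps)
qed

section \<open>Perfectness as an inequality for the exponents\<close>

lemma bij_betw_translation:
  fixes S :: "'a :: ab_group_add set"
  assumes "finite S" and "\<And>\<delta>. \<delta> \<in> S \<Longrightarrow> \<delta> + c \<in> S"
  shows "bij_betw (\<lambda>\<delta>. \<delta> + c) S S"
proof -
  have "inj_on (\<lambda>\<delta>. \<delta> + c) S"
    by (auto simp: inj_on_def)
  moreover have "(\<lambda>\<delta>. \<delta> + c) ` S = S"
    by (intro endo_inj_surj) (use assms in \<open>auto simp: inj_on_def\<close>)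
  ultimately show ?thesis
    by (simp add: bij_betw_def)
qed

text \<open>
  With \<open>A\<close> the argument of \<open>\<sigma>\<close>, multiplying \<open>\<sigma>(A)\<close> by the product of the \<open>x - \<gamma> - 1\<close> clears the denominators of the geometric
  sums. As \<open>1\<close> is a root of unity, translation by \<open>1\<close> permutes \<open>S\<close>, so this multiplier is the
  product of the \<open>x - \<gamma>\<close>; translation by the other roots of unity collects the factors of the
  numerators by their root \<open>\<delta> = \<gamma> + \<zeta>\<close>.
\<close>
lemma sigma_poly_roots_of_unity:
  fixes n :: "'a :: finite_field \<Rightarrow> nat"
  assumes p: "p = CHAR('a)" and N: "card {\<zeta> :: 'a. \<zeta> ^ N = 1} = N" "N \<ge> 1"
    and S: "\<And>\<delta> \<zeta>. \<delta> \<in> S \<Longrightarrow> \<zeta> ^ N = 1 \<Longrightarrow> \<delta> + \<zeta> \<in> S"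
  shows "sigma_poly (\<Prod>\<gamma>\<in>S. [:-\<gamma>, 1:] ^ (N * p ^ n \<gamma> - 1)) * (\<Prod>\<gamma>\<in>S. [:-\<gamma>, 1:]) =
    (\<Prod>\<delta>\<in>S. [:-\<delta>, 1:] ^ (\<Sum>\<zeta> | \<zeta> ^ N = 1. p ^ n (\<delta> - \<zeta>)))"
proof -
  let ?U = "{\<zeta> :: 'a. \<zeta> ^ N = 1}"
  have p0: "p > 0"
    using p by simp
  have bij: "bij_betw (\<lambda>\<delta>. \<delta> + \<zeta>) S S" if "\<zeta> \<in> ?U" for \<zeta>
    using that S by (intro bij_betw_translation) auto
  have one: "(\<Prod>\<gamma>\<in>S. [:-\<gamma>, 1:]) = (\<Prod>\<gamma>\<in>S. [:-\<gamma>, 1:] - 1)"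
  proof -
    have "(\<Prod>\<gamma>\<in>S. [:-\<gamma>, 1:]) = (\<Prod>\<gamma>\<in>S. [:-(\<gamma> + 1), 1:])"
      by (rule prod.reindex_bij_betw[symmetric, OF bij]) simp
    then show ?thesis
      by (simp add: one_pCons)
  qed
  have geom: "(\<Sum>i\<le>N * p ^ n \<gamma> - 1. [:-\<gamma>, 1:] ^ i) * ([:-\<gamma>, 1:] - 1) =
      (\<Prod>\<zeta>\<in>?U. [:-(\<gamma> + \<zeta>), 1:] ^ p ^ n \<gamma>)" for \<gamma> :: 'a
  proof -
    let ?L = "[:-\<gamma>, 1:]"
    have pos: "N * p ^ n \<gamma> > 0"
      using p0 N by simp
    then have "{..N * p ^ n \<gamma> - 1} = {..<N * p ^ n \<gamma>}"
      using lessThan_Suc_atMost[of "N * p ^ n \<gamma> - 1"] by simp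
    then have "(\<Sum>i\<le>N * p ^ n \<gamma> - 1. ?L ^ i) * (?L - 1) = (?L ^ N) ^ p ^ n \<gamma> - 1"
      using power_diff_1_eq[of ?L "N * p ^ n \<gamma>"] by (simp add: mult.commute power_mult[symmetric])
    \<comment> \<open>Frobenius is additive: apply it to the sum of \<open>y - 1\<close> and \<open>1\<close> with \<open>y = (x - \<gamma>) ^ N\<close>.\<close>
    also have "(?L ^ N) ^ p ^ n \<gamma> = ((?L ^ N - 1) + 1) ^ p ^ n \<gamma>"
      by simp
    also have "\<dots> = (?L ^ N - 1) ^ p ^ n \<gamma> + 1"
      using p by (subst freshmans_dream'[where n = "n \<gamma>"]) auto
    finally show ?thesis
      by (simp add: linear_power_minus_1_eq_prod[OF N] prod_power_distrib)
  qed
  have "sigma_poly (\<Prod>\<gamma>\<in>S. [:-\<gamma>, 1:] ^ (N * p ^ n \<gamma> - 1)) * (\<Prod>\<gamma>\<in>S. [:-\<gamma>, 1:]) =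
      (\<Prod>\<gamma>\<in>S. (\<Sum>i\<le>N * p ^ n \<gamma> - 1. [:-\<gamma>, 1:] ^ i) * ([:-\<gamma>, 1:] - 1))"
    by (simp add: sigma_poly_prod_linear_powers one prod.distrib)
  also have "\<dots> = (\<Prod>\<gamma>\<in>S. \<Prod>\<zeta>\<in>?U. [:-(\<gamma> + \<zeta>), 1:] ^ p ^ n \<gamma>)"
    by (simp only: geom)
  also have "\<dots> = (\<Prod>\<zeta>\<in>?U. \<Prod>\<gamma>\<in>S. [:-(\<gamma> + \<zeta>), 1:] ^ p ^ n (\<gamma> + \<zeta> - \<zeta>))"
    by (subst prod.swap) simp
  also have "\<dots> = (\<Prod>\<zeta>\<in>?U. \<Prod>\<delta>\<in>S. [:-\<delta>, 1:] ^ p ^ n (\<delta> - \<zeta>))"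
    by (intro prod.cong refl prod.reindex_bij_betw[OF bij]) auto
  also have "\<dots> = (\<Prod>\<delta>\<in>S. [:-\<delta>, 1:] ^ (\<Sum>\<zeta>\<in>?U. p ^ n (\<delta> - \<zeta>)))"
    by (subst prod.swap) (simp add: power_sum)
  finally show ?thesis .
qed

text \<open>
  Call the product \<open>A\<close>. Both \<open>A\<close> and \<open>\<sigma>(A)\<close> become products of linear powers over \<open>S\<close> after multiplication by the product
  of the \<open>x - \<gamma>\<close>; this raises the exponents of \<open>A\<close> from \<open>N p ^ n(\<gamma>) - 1\<close> to \<open>N p ^ n(\<gamma>)\<close>. Divisibility
  then is a comparison of exponents.
\<close>
lemma perfect_poly_iff_subharmonic:
  fixes n :: "'a :: finite_field \<Rightarrow> nat"
  assumes p: "p = CHAR('a)" and N: "card {\<zeta> :: 'a. \<zeta> ^ N = 1} = N" "N \<ge> 1"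
    and S: "\<And>\<delta> \<zeta>. \<delta> \<in> S \<Longrightarrow> \<zeta> ^ N = 1 \<Longrightarrow> \<delta> + \<zeta> \<in> S"
  shows "perfect_poly (\<Prod>\<gamma>\<in>S. [:-\<gamma>, 1:] ^ (N * p ^ n \<gamma> - 1)) \<longleftrightarrow>
    (\<forall>\<delta>\<in>S. N * p ^ n \<delta> \<le> (\<Sum>\<zeta> | \<zeta> ^ N = 1. p ^ n (\<delta> - \<zeta>)))"
proof -
  let ?A = "\<Prod>\<gamma>\<in>S. [:-\<gamma>, 1:] ^ (N * p ^ n \<gamma> - 1)"
  let ?R = "\<Prod>\<gamma>\<in>S. [:-\<gamma>, 1:]"
  have "?A * ?R = (\<Prod>\<gamma>\<in>S. [:-\<gamma>, 1:] ^ Suc (N * p ^ n \<gamma> - 1))"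
    by (simp only: power_Suc2 prod.distrib)
  then have AR: "?A * ?R = (\<Prod>\<gamma>\<in>S. [:-\<gamma>, 1:] ^ (N * p ^ n \<gamma>))"
    using p N by simp
  have "lead_coeff ?A = 1"
    by (simp add: lead_coeff_prod lead_coeff_power)
  moreover have "?A dvd sigma_poly ?A \<longleftrightarrow> ?A * ?R dvd sigma_poly ?A * ?R"
    by (subst dvd_mult_cancel_right) auto
  ultimately show ?thesis
    unfolding perfect_poly_def
    by (simp only: AR sigma_poly_roots_of_unity[OF p N S] prod_linear_powers_dvd_iff[OF finite] simp_thms)
qed

section \<open>Subharmonic functions on a finite group\<close>

text \<open>
  An energy argument. Expanding the squares and using that translations preserve \<open>\<Sum>\<delta>. f(\<delta>)\<^sup>2\<close>, the
  energy \<open>\<Sum>\<delta>. \<Sum>\<zeta>\<in>U. (f(\<delta>) - f(\<delta> - \<zeta>))\<^sup>2\<close> equals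
  \<open>2 (\<Sum>\<delta>. f(\<delta>) (card U * f(\<delta>) - (\<Sum>\<zeta>\<in>U. f(\<delta> - \<zeta>))))\<close>, which is not positive because
  \<open>f \<ge> 0\<close>. So every square vanishes.
\<close>
lemma subharmonic_imp_invariant:
  fixes f :: "'a :: {ab_group_add, finite} \<Rightarrow> real"
  assumes nonneg: "\<And>\<delta>. f \<delta> \<ge> 0"
    and sub: "\<And>\<delta>. real (card U) * f \<delta> \<le> (\<Sum>\<zeta>\<in>U. f (\<delta> - \<zeta>))"
    and "\<zeta> \<in> U"
  shows "f (\<delta> - \<zeta>) = f \<delta>"
proof -
  let ?E = "\<Sum>\<delta>\<in>UNIV. \<Sum>\<zeta>\<in>U. (f \<delta> - f (\<delta> - \<zeta>))\<^sup>2"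
  have shift: "(\<Sum>\<delta>\<in>UNIV. (f (\<delta> - \<zeta>))\<^sup>2) = (\<Sum>\<delta>\<in>UNIV. (f \<delta>)\<^sup>2)" for \<zeta>
    by (rule sum.reindex_bij_witness[of _ "\<lambda>\<delta>. \<delta> + \<zeta>" "\<lambda>\<delta>. \<delta> - \<zeta>"]) auto
  have shift': "(\<Sum>\<delta>\<in>UNIV. \<Sum>\<zeta>\<in>U. (f (\<delta> - \<zeta>))\<^sup>2) = real (card U) * (\<Sum>\<delta>\<in>UNIV. (f \<delta>)\<^sup>2)"
    by (subst sum.swap) (simp add: shift)
  have "?E = (\<Sum>\<delta>\<in>UNIV. \<Sum>\<zeta>\<in>U. (f \<delta>)\<^sup>2 + (f (\<delta> - \<zeta>))\<^sup>2 - 2 * (f \<delta> * f (\<delta> - \<zeta>)))"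
    by (simp add: power2_diff mult.assoc)
  also have "\<dots> = 2 * (real (card U) * (\<Sum>\<delta>\<in>UNIV. (f \<delta>)\<^sup>2))
      - 2 * (\<Sum>\<delta>\<in>UNIV. f \<delta> * (\<Sum>\<zeta>\<in>U. f (\<delta> - \<zeta>)))"
    by (simp add: sum.distrib sum_subtractf shift' sum_distrib_left)
  also have "\<dots> \<le> 0"
  proof -
    have "real (card U) * (\<Sum>\<delta>\<in>UNIV. (f \<delta>)\<^sup>2) = (\<Sum>\<delta>\<in>UNIV. f \<delta> * (real (card U) * f \<delta>))"
      by (simp add: sum_distrib_left power2_eq_square mult_ac)
    also have "\<dots> \<le> (\<Sum>\<delta>\<in>UNIV. f \<delta> * (\<Sum>\<zeta>\<in>U. f (\<delta> - \<zeta>)))"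
      by (intro sum_mono mult_left_mono sub nonneg)
    finally show ?thesis
      by simp
  qed
  finally have "?E \<le> 0" .
  moreover have "?E \<ge> 0"
    by (intro sum_nonneg) auto
  ultimately have "?E = 0"
    by simp
  then have "(\<Sum>\<zeta>\<in>U. (f \<delta> - f (\<delta> - \<zeta>))\<^sup>2) = 0"
    by (subst (asm) sum_nonneg_eq_0_iff) (auto intro: sum_nonneg)
  then have "(f \<delta> - f (\<delta> - \<zeta>))\<^sup>2 = 0"
    using \<open>\<zeta> \<in> U\<close> by (subst (asm) sum_nonneg_eq_0_iff) auto
  then show ?thesis
    by simp
qed

section \<open>The prime subfield\<close>

text \<open>
  The prime subfield has at least \<open>CHAR('a)\<close> elements and is fixed by Frobenius, whereas
  \<open>x ^ CHAR('a) - x\<close> has at most \<open>CHAR('a)\<close> roots.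
\<close>
lemma prime_subfield_eq_Frobenius_fixed:
  "prime_subfield = {x :: 'a :: finite_field. x ^ CHAR('a) = x}"
  "card (prime_subfield :: 'a set) = CHAR('a)"
proof -
  let ?p = "CHAR('a)"
  have p1: "1 < ?p"
    using CHAR_prime[where ?'a = 'a] prime_gt_1_nat by blast
  have fixed: "(of_nat k :: 'a) ^ ?p = of_nat k" for k
    by (induction k) (use p1 in \<open>auto simp: freshmans_dream\<close>)
  have sub: "prime_subfield \<subseteq> {x :: 'a. x ^ ?p = x}"
    by (auto simp: prime_subfield_def fixed)
  have inj: "inj_on (of_nat :: nat \<Rightarrow> 'a) {..<?p}"
  proof (rule linorder_inj_onI')
    fix i j assume ij: "i \<in> {..<?p}" "j \<in> {..<?p}" "i < j"
    then have "\<not> ?p dvd j - i"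
      by (auto dest: dvd_imp_le)
    with \<open>i < j\<close> show "(of_nat i :: 'a) \<noteq> of_nat j"
      by (simp add: of_nat_eq_iff_char_dvd)
  qed
  have lower: "?p \<le> card (prime_subfield :: 'a set)"
    using card_mono[of "prime_subfield :: 'a set" "of_nat ` {..<?p}"] card_image[OF inj]
    by (auto simp: prime_subfield_def)
  have upper: "card {x :: 'a. x ^ ?p = x} \<le> ?p"
    using card_equal_powers_le[OF p1, where ?'a = 'a] by simp
  show "prime_subfield = {x :: 'a. x ^ ?p = x}"
    by (intro card_subset_eq sub) (use lower upper card_mono[OF _ sub] in auto)
  then show "card (prime_subfield :: 'a set) = ?p"
    using lower upper by simp
qed

text \<open>
  If all \<open>N\<close> roots of unity lie in the prime subfield, they satisfy \<open>\<zeta> ^ (CHAR('a) - 1) = 1\<close>, hence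
  also \<open>\<zeta> ^ r = 1\<close> for the remainder \<open>r\<close> of \<open>CHAR('a) - 1\<close> modulo \<open>N\<close>. As \<open>r < N\<close>, this is too
  many roots of \<open>x ^ r - 1\<close> unless \<open>r = 0\<close>.
\<close>
lemma roots_of_unity_subset_prime_subfield_iff:
  assumes N: "card {\<zeta> :: 'a :: finite_field. \<zeta> ^ N = 1} = N" "N \<ge> 1"
  shows "{\<zeta> :: 'a. \<zeta> ^ N = 1} \<subseteq> prime_subfield \<longleftrightarrow> N dvd CHAR('a) - 1"
proof
  let ?p = "CHAR('a)"
  have split: "x ^ (?p - 1) * x = x ^ ?p" for x :: 'a
    by (rule power_minus_mult) simp
  {
    assume "N dvd ?p - 1"
    then obtain k where k: "?p - 1 = N * k"
      by auto
    have "\<zeta> ^ ?p = \<zeta>" if "\<zeta> ^ N = 1" for \<zeta> :: 'a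
    proof -
      have "\<zeta> ^ (?p - 1) = 1"
        by (simp only: k power_mult that power_one)
      with split[of \<zeta>] show ?thesis
        by simp
    qed
    then show "{\<zeta> :: 'a. \<zeta> ^ N = 1} \<subseteq> prime_subfield"
      by (auto simp: prime_subfield_eq_Frobenius_fixed)
  next
    assume sub: "{\<zeta> :: 'a. \<zeta> ^ N = 1} \<subseteq> prime_subfield"
    define r where "r = (?p - 1) mod N"
    have r: "\<zeta> ^ r = 1" if \<zeta>: "\<zeta> ^ N = 1" for \<zeta> :: 'a
    proof -
      have "\<zeta> \<noteq> 0"
        using \<zeta> N by (auto simp: power_0_left)
      moreover have "\<zeta> ^ (?p - 1) * \<zeta> = \<zeta>"
        using sub \<zeta> unfolding split by (auto simp: prime_subfield_eq_Frobenius_fixed)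
      ultimately have "\<zeta> ^ (?p - 1) = 1"
        by simp
      moreover have "\<zeta> ^ (?p - 1) = \<zeta> ^ (N * ((?p - 1) div N) + r)"
        by (simp add: r_def)
      ultimately show ?thesis
        by (simp add: power_add power_mult \<zeta>)
    qed
    have "r = 0"
    proof (rule ccontr)
      assume "r \<noteq> 0"
      have "N = card {\<zeta> :: 'a. \<zeta> ^ N = 1}"
        using N by simp
      also have "\<dots> \<le> card {\<zeta> :: 'a. \<zeta> ^ r = 1}"
        by (intro card_mono) (auto simp: r)
      also have "\<dots> \<le> r"
        using card_equal_powers_le[of 0 r, where ?'a = 'a] \<open>r \<noteq> 0\<close> by simp
      also have "r < N"
        using N by (simp add: r_def)
      finally show False
        by simp
    qed
    then show "N dvd ?p - 1"
      by (simp add: r_def dvd_eq_mod_eq_0)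
  }
qed

text \<open>
  The combinations \<open>u + v \<zeta>\<close> with \<open>u\<close> and \<open>v\<close> in the prime subfield are pairwise distinct, since a
  coincidence would express \<open>\<zeta>\<close> as a quotient of elements of the prime subfield. There are as
  many of them as elements of the field.
\<close>
lemma prime_subfield_span_quadratic:
  assumes card: "card (UNIV :: 'a :: finite_field set) = CHAR('a) ^ 2"
    and \<zeta>: "(\<zeta> :: 'a) \<notin> prime_subfield"
  shows "\<exists>i j. x = of_nat i + of_nat j * \<zeta>"
proof -
  let ?F = "prime_subfield :: 'a set"
  let ?p = "CHAR('a)"
  have diff: "(u - v) ^ ?p = u ^ ?p - v ^ ?p" for u v :: 'a
    using freshmans_dream[of ?p "u - v" v] by simp
  have "inj_on (\<lambda>(u, v). u + v * \<zeta>) (?F \<times> ?F)"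
  proof (rule inj_onI, clarify)
    fix u v u' v'
    assume F: "u \<in> ?F" "v \<in> ?F" "u' \<in> ?F" "v' \<in> ?F" and eq: "u + v * \<zeta> = u' + v' * \<zeta>"
    have "v = v'"
    proof (rule ccontr)
      assume "v \<noteq> v'"
      with eq have "\<zeta> = (u' - u) / (v - v')"
        by (simp add: field_simps)
      then have "\<zeta> ^ ?p = \<zeta>"
        using F by (simp add: power_divide diff prime_subfield_eq_Frobenius_fixed)
      with \<zeta> show False
        by (simp add: prime_subfield_eq_Frobenius_fixed)
    qed
    with eq show "u = u' \<and> v = v'"
      by simp
  qed
  then have "card ((\<lambda>(u, v). u + v * \<zeta>) ` (?F \<times> ?F)) = card (UNIV :: 'a set)"
    by (simp add: card_image card_cartesian_product card prime_subfield_eq_Frobenius_fixed(2) power2_eq_square)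
  then have "(\<lambda>(u, v). u + v * \<zeta>) ` (?F \<times> ?F) = UNIV"
    by (intro card_subset_eq) auto
  then have "x \<in> (\<lambda>(u, v). u + v * \<zeta>) ` (?F \<times> ?F)"
    by simp
  then obtain u v where "u \<in> ?F" "v \<in> ?F" "x = u + v * \<zeta>"
    by auto
  then show ?thesis
    by (auto simp: prime_subfield_def)
qed

text \<open>
  Translating the summation variable by \<open>1\<close> in the sum of all field elements shows that the
  cardinality vanishes in the field.
\<close>
lemma CHAR_dvd_card_UNIV:
  "CHAR('a :: finite_field) dvd card (UNIV :: 'a set)"
proof -
  have "(\<Sum>x\<in>(UNIV :: 'a set). x) = (\<Sum>x\<in>(UNIV :: 'a set). x + 1)"
    by (rule sum.reindex_bij_witness[of _ "\<lambda>x. x + 1" "\<lambda>x. x - 1"]) auto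
  then have "of_nat (card (UNIV :: 'a set)) = (0 :: 'a)"
    by (simp add: sum.distrib)
  then show ?thesis
    by (simp add: of_nat_eq_0_iff_char_dvd)
qed

section \<open>Perfect polynomials over the field with \<open>p\<^sup>2\<close> elements\<close>

theorem theorem1p1:
  fixes p q N :: nat
    and n :: "'a :: finite_field \<Rightarrow> nat"
    and A :: "'a poly"
  assumes "prime p" and "q = p ^ 2" and "card (UNIV :: 'a set) = q"
    and "N \<ge> 1" and "N dvd q - 1"
    and "A = (\<Prod>\<gamma>\<in>UNIV. [:- \<gamma>, 1:] ^ (N * p ^ n \<gamma> - 1))"
    and "perfect_poly A"
  shows "(N dvd p - 1 \<longrightarrow> trivially_perfect p N n) \<and>
         (\<not> N dvd p - 1 \<longrightarrow>
            (\<forall>\<gamma> \<delta>. n \<gamma> = n \<delta>) \<and>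
            (\<forall>\<gamma>. A = (monom 1 q - monom 1 1) ^ (N * p ^ n \<gamma> - 1)))"
proof -
  have "CHAR('a) dvd p ^ 2"
    using CHAR_dvd_card_UNIV[where ?'a = 'a] assms by simp
  then have "CHAR('a) dvd p"
    using CHAR_prime[where ?'a = 'a] by (rule prime_dvd_power[rotated])
  then have p: "p = CHAR('a)"
    using \<open>prime p\<close> CHAR_prime[where ?'a = 'a] primes_dvd_imp_eq by metis
  have N: "card {\<zeta> :: 'a. \<zeta> ^ N = 1} = N" "N \<ge> 1"
    using card_roots_of_unity_finite_field[of N, where ?'a = 'a] assms(3-5) by simp_all
  have sub: "N * p ^ n \<delta> \<le> (\<Sum>\<zeta> | \<zeta> ^ N = 1. p ^ n (\<delta> - \<zeta>))" for \<delta>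
    using \<open>perfect_poly A\<close> unfolding assms(6)
    by (subst (asm) perfect_poly_iff_subharmonic[OF p N]) auto
  have "trivially_perfect p N n" if "N dvd p - 1"
    unfolding trivially_perfect_def coset_factor_coset
  proof (intro allI perfect_poly_iff_subharmonic[OF p N, THEN iffD2] ballI sub)
    fix a \<delta> \<zeta> :: 'a
    assume "\<delta> \<in> (\<lambda>j. a + j) ` prime_subfield" and "\<zeta> ^ N = 1"
    moreover have "\<zeta> \<in> prime_subfield"
      using roots_of_unity_subset_prime_subfield_iff[OF N] that \<open>\<zeta> ^ N = 1\<close> p by blast
    ultimately obtain i j where "\<delta> = a + of_nat i" "\<zeta> = of_nat j"
      by (auto simp: prime_subfield_def)
    then show "\<delta> + \<zeta> \<in> (\<lambda>j. a + j) ` prime_subfield"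
      by (intro image_eqI[of _ _ "of_nat (i + j)"]) (auto simp: prime_subfield_def simp flip: of_nat_add)
  qed
  moreover have "(\<forall>\<gamma> \<delta>. n \<gamma> = n \<delta>) \<and>
      (\<forall>\<gamma>. A = (monom 1 q - monom 1 1) ^ (N * p ^ n \<gamma> - 1))" if not_dvd: "\<not> N dvd p - 1"
  proof
    obtain \<zeta> :: 'a where \<zeta>: "\<zeta> ^ N = 1" "\<zeta> \<notin> prime_subfield"
      using roots_of_unity_subset_prime_subfield_iff[OF N] not_dvd p by blast
    have inv: "n (\<delta> + \<xi>) = n \<delta>" if "\<xi> ^ N = 1" for \<delta> \<xi>
    proof -
      have "real (p ^ n (\<delta> + \<xi> - \<xi>)) = real (p ^ n (\<delta> + \<xi>))"
      proof (rule subharmonic_imp_invariant[where U = "{\<zeta>. \<zeta> ^ N = 1}"])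
        fix \<delta> :: 'a
        have "real (N * p ^ n \<delta>) \<le> real (\<Sum>\<zeta> | \<zeta> ^ N = 1. p ^ n (\<delta> - \<zeta>))"
          using sub by (simp only: of_nat_le_iff)
        then show "real (card {\<zeta> :: 'a. \<zeta> ^ N = 1}) * real (p ^ n \<delta>)
            \<le> (\<Sum>\<zeta> | \<zeta> ^ N = 1. real (p ^ n (\<delta> - \<zeta>)))"
          by (simp add: N)
      qed (use that in auto)
      then show ?thesis
        using prime_gt_1_nat[OF \<open>prime p\<close>] by simp
    qed
    have inv': "n (\<delta> + of_nat j * \<xi>) = n \<delta>" if "\<xi> ^ N = 1" for \<delta> \<xi> j
    proof (induction j)
      case (Suc j)
      have "n (\<delta> + of_nat (Suc j) * \<xi>) = n (\<delta> + of_nat j * \<xi> + \<xi>)"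
        by (simp add: algebra_simps)
      with Suc inv[OF that] show ?case
        by simp
    qed simp
    \<comment> \<open>\<open>1\<close> and \<open>\<zeta>\<close> are periods of \<open>n\<close> and generate the field additively.\<close>
    have "n \<gamma> = n 0" for \<gamma>
    proof -
      obtain i j where "\<gamma> = of_nat i + of_nat j * \<zeta>"
        using prime_subfield_span_quadratic[OF _ \<zeta>(2), of \<gamma>] assms p by auto
      then show ?thesis
        using inv'[OF \<zeta>(1), of "of_nat i" j] inv'[of 1 0 i] by simp
    qed
    then show const: "\<forall>\<gamma> \<delta>. n \<gamma> = n \<delta>"
      by metis
    show "\<forall>\<gamma>. A = (monom 1 q - monom 1 1) ^ (N * p ^ n \<gamma> - 1)"
    proof
      fix \<gamma>
      have "A = (\<Prod>\<delta>\<in>UNIV. [:- \<delta>, 1:] ^ (N * p ^ n \<gamma> - 1))"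
        unfolding assms(6) using const by (intro prod.cong) metis+
      then show "A = (monom 1 q - monom 1 1) ^ (N * p ^ n \<gamma> - 1)"
        by (simp only: prod_power_distrib monom_card_minus_X assms(3)[symmetric])
    qed
  qed
  ultimately show ?thesis
    by blast
qed

end
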